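(* Let $V$, $H$ be real Hilbert spaces, $A : V \to H$ a bounded injective linear operator with adjoint $A^* : H \to V$, and $P : H \to H$ a compact orthogonal projector with $\mathrm{Range}\, P \subset \overline{\mathrm{Range}\, A}$. Let $\delta > 0$ and $g^\delta \in H$ with $\|g_\perp^\delta\|_H < \delta$. Then the optimization problem $$\inf_{q \in H} G_P^\delta(q), \qquad G_P^\delta(q) = \frac{1}{2}\|A^* q\|_V^2 + \delta \|(I-P) q\|_H - (g^\delta, q)_H,$$ has at least one solution $p^\delta \in H$. Moreover, $u^\delta = A^* p^\delta$ belongs to the set $$K_P^\delta = \{ v \in V : \|Av - g^\delta\|_H \le \delta,\ PAv = Pg^\delta \},$$ and $$\|u^\delta\|_V^2 + 2\, G_P^\delta(p^\delta) = 0.$$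
   Context: $g_\perp^\delta$ denotes the orthogonal projection of $g^\delta$ on $(\mathrm{Range}\, A)^\perp \subset H$. $I$ is the identity operator of $H$. $P$ is the orthogonal projector on a closed subspace of $H$. The properties stated for $u^\delta = A^*p^\delta$ are for any solution $p^\delta$ of the optimization problem. *)

theory Defs
  imports "HOL-Analysis.Analysis"
begin

definition compact_operator ::
  "('a::real_normed_vector \<Rightarrow> 'b::real_normed_vector) \<Rightarrow> bool"
  where "compact_operator T \<longleftrightarrow>
    bounded_linear T \<and> (\<forall>S. bounded S \<longrightarrow> compact (closure (T ` S)))"

(* Meaningful for closed subspaces M of a Hilbert space, where the projection
   theorem gives existence and uniqueness of y. The library's closest_point is
   restricted to spaces with the Heine-Borel property. *)
definition orth_proj :: "'a::real_inner set \<Rightarrow> 'a \<Rightarrow> 'a"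
  where "orth_proj M x = (THE y. y \<in> M \<and> x - y \<in> orthogonal_comp M)"

definition orthogonal_projector :: "('a::real_inner \<Rightarrow> 'a) \<Rightarrow> bool"
  where "orthogonal_projector P \<longleftrightarrow>
    (\<exists>M. subspace M \<and> closed M \<and> P = orth_proj M)"

(* adjoint is defined by choice; for bounded A between Hilbert spaces it is the
   unique map with A x \<bullet> y = x \<bullet> adjoint A y. *)
definition G_obj ::
  "('v::real_inner \<Rightarrow> 'h::real_inner) \<Rightarrow> ('h \<Rightarrow> 'h) \<Rightarrow> real \<Rightarrow> 'h \<Rightarrow> 'h \<Rightarrow> real"
  where "G_obj A P \<delta> g q =
    1 / 2 * (norm (adjoint A q))\<^sup>2 + \<delta> * norm (q - P q) - g \<bullet> q"

definition K_set ::
  "('v::real_inner \<Rightarrow> 'h::real_inner) \<Rightarrow> ('h \<Rightarrow> 'h) \<Rightarrow> real \<Rightarrow> 'h \<Rightarrow> 'v set"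
  where "K_set A P \<delta> g = {v. norm (A v - g) \<le> \<delta> \<and> P (A v) = P g}"

end

theory Submission
  imports Defs
begin

text \<open>
  The objective \<open>G\<close> is convex and continuous, so a minimiser exists as soon as \<open>G\<close> grows at
  least linearly. In a Hilbert space this needs no weak topology: sublevel sets shrinking to the
  infimum are nested, closed, convex and bounded, and by the parallelogram law their near-minimal
  vectors form a Cauchy sequence, whose limit lies in all of them. The same minimisation principle
  yields the projection theorem and the Riesz representation, hence the adjoint \<open>A\<^sup>*\<close>.

  Linear growth (lemma \<open>G_obj_coercive\<close>) rests on two estimates modulo \<open>\<parallel>A\<^sup>* q\<parallel>\<close>, a quantity that
  the quadratic term of \<open>G\<close> dominates. First, up to an arbitrarily small multiple of \<open>\<parallel>q\<parallel>\<close>,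
  \<open>\<parallel>P q\<parallel>\<close> is at most \<open>C \<parallel>A\<^sup>* q\<parallel>\<close>: by compactness, the \<open>P\<close>-image of the unit ball is approximated by
  finitely many vectors \<open>A v\<close>, and \<open>(A v, q) = (v, A\<^sup>* q)\<close>. So \<open>\<parallel>(I - P) q\<parallel>\<close> is almost \<open>\<parallel>q\<parallel>\<close>.
  Second, since \<open>g - g\<^sub>\<bottom>\<close> lies in the closure of the range of \<open>A\<close>, the term \<open>(g, q)\<close> is at most
  about \<open>\<parallel>g\<^sub>\<bottom>\<parallel> \<parallel>q\<parallel>\<close>. The hypothesis \<open>\<parallel>g\<^sub>\<bottom>\<parallel> < \<delta>\<close> leaves a positive multiple of \<open>\<parallel>q\<parallel>\<close>.

  For a minimiser \<open>p\<close> with \<open>u = A\<^sup>* p\<close>, the one-sided directional derivatives of \<open>G\<close> at \<open>p\<close> are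
  nonnegative, so \<open>(A u - g, h) + \<delta> \<parallel>(I - P) h\<parallel> \<ge> 0\<close> for every \<open>h\<close>. Testing with
  \<open>h = - P (A u - g)\<close>, on which the norm term vanishes, gives \<open>P A u = P g\<close>; testing with
  \<open>h = - (A u - g)\<close> gives \<open>\<parallel>A u - g\<parallel> \<le> \<delta>\<close>. Along the ray through \<open>p\<close> both one-sided
  derivatives are available, which gives \<open>\<parallel>u\<parallel>\<^sup>2 + \<delta> \<parallel>(I - P) p\<parallel> - (g, p) = 0\<close>; this is the
  energy identity after doubling \<open>G\<close>.
\<close>

section \<open>Minimising convex functions in Hilbert spaces\<close>

text \<open>
  A substitute for weak compactness of bounded closed convex sets. The distances \<open>d n\<close> from \<open>0\<close> to
  \<open>C n\<close> increase to a limit. A midpoint of near-minimal vectors of \<open>C m\<close> and \<open>C n\<close> with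
  \<open>n \<le> m\<close> still lies in \<open>C n\<close>, so its norm is at least \<open>d n\<close>, and the parallelogram law forces the
  two vectors to be close.
\<close>
lemma decreasing_closed_convex_Inter_nonempty:
  fixes C :: "nat \<Rightarrow> 'a::{real_inner,complete_space} set"
  assumes closed: "\<And>n. closed (C n)" and conv: "\<And>n. convex (C n)"
    and dec: "decseq C" and bdd: "\<And>n. \<exists>x\<in>C n. norm x \<le> M"
  shows "(\<Inter>n. C n) \<noteq> {}"
proof -
  define d where "d n = infdist 0 (C n)" for n
  define a where "a n = d n + 1 / real (Suc n)" for n
  have ne: "C n \<noteq> {}" for n
    using bdd[of n] by auto
  have d_le: "d n \<le> norm x" if "x \<in> C n" for n x
    using infdist_le[OF that, of 0] by (simp add: d_def)
  have d_nonneg: "0 \<le> d n" for n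
    by (simp add: d_def infdist_nonneg)
  have "incseq d"
    unfolding incseq_def d_def using dec ne by (auto simp: decseq_def intro!: infdist_mono)
  moreover have "d n \<le> M" for n
    using bdd[of n] d_le[of _ n] by force
  ultimately obtain l where l: "d \<longlonglongrightarrow> l"
    using incseq_convergent[of d M] by metis
  have a: "a \<longlonglongrightarrow> l"
    unfolding a_def using tendsto_add[OF l LIMSEQ_inverse_real_of_nat]
    by (simp add: inverse_eq_divide)
  have "\<exists>x\<in>C n. norm x < a n" for n
  proof -
    have "infdist 0 (C n) < a n"
      by (simp add: a_def d_def)
    moreover have "bdd_below (norm ` C n)"
      by (rule bdd_belowI2) (rule norm_ge_zero)
    ultimately show ?thesis
      using cINF_less_iff[OF ne[of n], of norm "a n"] ne[of n] by (simp add: infdist_def)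
  qed
  then obtain x where x: "\<And>n. x n \<in> C n" "\<And>n. norm (x n) < a n"
    by metis
  have "Cauchy x"
  proof (rule metric_CauchyI)
    fix e :: real assume e: "e > 0"
    have "\<forall>\<^sub>F n in sequentially. (a n)\<^sup>2 < l\<^sup>2 + e\<^sup>2 / 8"
      using tendsto_power[OF a, of 2] e by (intro order_tendstoD(2)) auto
    moreover have "\<forall>\<^sub>F n in sequentially. (d n)\<^sup>2 > l\<^sup>2 - e\<^sup>2 / 8"
      using tendsto_power[OF l, of 2] e by (intro order_tendstoD(1)) auto
    ultimately have "\<forall>\<^sub>F n in sequentially. (a n)\<^sup>2 < l\<^sup>2 + e\<^sup>2 / 8 \<and> (d n)\<^sup>2 > l\<^sup>2 - e\<^sup>2 / 8"
      by eventually_elim auto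
    then obtain N where N: "\<And>n. n \<ge> N \<Longrightarrow> (a n)\<^sup>2 < l\<^sup>2 + e\<^sup>2 / 8"
      "\<And>n. n \<ge> N \<Longrightarrow> (d n)\<^sup>2 > l\<^sup>2 - e\<^sup>2 / 8"
      unfolding eventually_sequentially by blast
    have *: "dist (x m) (x n) < e" if mn: "n \<ge> N" "m \<ge> n" for m n
    proof -
      have "x m \<in> C n"
        using x(1)[of m] dec mn by (auto simp: decseq_def)
      then have "(1/2) *\<^sub>R x m + (1/2) *\<^sub>R x n \<in> C n"
        using conv[of n] x(1)[of n] by (intro convexD) auto
      then have "d n \<le> norm ((1/2) *\<^sub>R x m + (1/2) *\<^sub>R x n)"
        by (rule d_le)
      then have mid: "(d n)\<^sup>2 \<le> (norm ((1/2) *\<^sub>R x m + (1/2) *\<^sub>R x n))\<^sup>2"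
        using d_nonneg power_mono by blast
      have "(norm (x m))\<^sup>2 \<le> (a m)\<^sup>2" "(norm (x n))\<^sup>2 \<le> (a n)\<^sup>2"
        using x(2) by (simp_all add: power_mono less_imp_le)
      moreover have "(norm (x m - x n))\<^sup>2 =
          2 * (norm (x m))\<^sup>2 + 2 * (norm (x n))\<^sup>2 - 4 * (norm ((1/2) *\<^sub>R x m + (1/2) *\<^sub>R x n))\<^sup>2"
        by (simp add: power2_norm_eq_inner inner_simps inner_commute)
      ultimately have "(norm (x m - x n))\<^sup>2 < e\<^sup>2"
        using N(1)[of m] N(1)[of n] N(2)[of n] mid mn by linarith
      then show ?thesis
        using e by (simp add: dist_norm power2_less_imp_less)
    qed
    have "dist (x m) (x n) < e" if "m \<ge> N" "n \<ge> N" for m n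
      using *[of n m] *[of m n] that by (cases "m \<ge> n") (auto simp: dist_commute)
    then show "\<exists>N. \<forall>m\<ge>N. \<forall>n\<ge>N. dist (x m) (x n) < e"
      by blast
  qed
  then obtain y where y: "x \<longlonglongrightarrow> y"
    using Cauchy_convergent convergent_def by blast
  have "y \<in> C n" for n
  proof (rule Lim_in_closed_set[OF closed _ _ y])
    show "\<forall>\<^sub>F k in sequentially. x k \<in> C n"
      using eventually_ge_at_top[of n]
      by eventually_elim (use x(1) dec in \<open>auto simp: decseq_def\<close>)
  qed simp
  then show ?thesis
    by blast
qed

text \<open>
  The sublevel sets at the levels \<open>m + 1 / (n + 1)\<close>, with \<open>m\<close> the infimum, satisfy the hypotheses
  of the intersection lemma. Linear growth serves twice: it bounds \<open>f\<close> below, and it bounds the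
  first sublevel set.
\<close>
lemma convex_coercive_attains_minimum:
  fixes f :: "'a::{real_inner,complete_space} \<Rightarrow> real"
  assumes S: "closed S" "S \<noteq> {}" and conv: "convex_on S f" and cont: "continuous_on S f"
    and c: "c > 0" and growth: "\<And>x. x \<in> S \<Longrightarrow> c * norm x - b \<le> f x"
  shows "\<exists>x\<in>S. \<forall>y\<in>S. f x \<le> f y"
proof -
  define m where "m = (INF x\<in>S. f x)"
  define C where "C n = {x\<in>S. f x \<le> m + 1 / real (Suc n)}" for n
  have bdd: "bdd_below (f ` S)"
  proof (rule bdd_belowI2)
    fix x assume "x \<in> S"
    then show "- b \<le> f x"
      using growth[of x] zero_le_mult_iff[of c "norm x"] c norm_ge_zero[of x] by linarith
  qed
  have m_le: "m \<le> f x" if "x \<in> S" for x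
    unfolding m_def using bdd that by (rule cINF_lower)
  have "(\<Inter>n. C n) \<noteq> {}"
  proof (rule decreasing_closed_convex_Inter_nonempty)
    fix n
    have "closed (S \<inter> f -` {..m + 1 / real (Suc n)})"
      using cont S(1) by (intro continuous_closed_preimage) auto
    moreover have "S \<inter> f -` {..m + 1 / real (Suc n)} = C n"
      by (auto simp: C_def)
    ultimately show "closed (C n)"
      by simp
    show "convex (C n)"
    proof (rule convexI)
      fix x y and u v :: real
      assume xy: "x \<in> C n" "y \<in> C n" and uv: "0 \<le> u" "0 \<le> v" "u + v = 1"
      then have "f (u *\<^sub>R x + v *\<^sub>R y) \<le> u * f x + v * f y" "u *\<^sub>R x + v *\<^sub>R y \<in> S"
        using conv by (auto simp: convex_on_def C_def convexD)
      moreover have "u * f x + v * f y \<le> m + 1 / real (Suc n)"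
        using xy uv by (intro convex_bound_le) (auto simp: C_def)
      ultimately show "u *\<^sub>R x + v *\<^sub>R y \<in> C n"
        by (simp add: C_def)
    qed
    have "\<exists>x\<in>S. f x < m + 1 / real (Suc n)"
      using cINF_less_iff[OF S(2) bdd, of "m + 1 / real (Suc n)"] by (simp add: m_def)
    then obtain x where x: "x \<in> S" "f x < m + 1 / real (Suc n)"
      by blast
    have "1 / real (Suc n) \<le> 1"
      by simp
    then have "c * norm x \<le> m + 1 + b"
      using growth[OF x(1)] x(2) by linarith
    then have "norm x \<le> (m + 1 + b) / c"
      using c by (simp add: pos_le_divide_eq mult.commute)
    then show "\<exists>x\<in>C n. norm x \<le> (m + 1 + b) / c"
      using x by (auto simp: C_def)
  next
    show "decseq C"
    proof (rule decseq_SucI)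
      fix n
      have "1 / real (Suc (Suc n)) \<le> 1 / real (Suc n)"
        by (intro divide_left_mono) auto
      then show "C (Suc n) \<subseteq> C n"
        unfolding C_def by auto
    qed
  qed
  then obtain x where x: "\<And>n. x \<in> C n"
    by blast
  have "(\<lambda>n. m + 1 / real (Suc n)) \<longlonglongrightarrow> m"
    using LIMSEQ_inverse_real_of_nat_add[of m] by (simp add: inverse_eq_divide)
  then have "f x \<le> m"
    by (rule LIMSEQ_le_const) (use x in \<open>auto simp: C_def\<close>)
  then show ?thesis
    using x[of 0] m_le by (force simp: C_def)
qed

lemma convex_on_compose_linear:
  assumes "convex_on UNIV f" "linear T"
  shows "convex_on UNIV (\<lambda>x. f (T x))"
  using assms by (simp add: convex_on_def linear_add linear_scale)

lemma convex_on_norm_square: "convex_on UNIV (\<lambda>x::'a::real_inner. (norm x)\<^sup>2)"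
proof (rule convex_onI)
  fix t :: real and x y :: 'a
  assume t: "0 < t" "t < 1"
  have "(1 - t) * (norm x)\<^sup>2 + t * (norm y)\<^sup>2 - (norm ((1 - t) *\<^sub>R x + t *\<^sub>R y))\<^sup>2
      = t * (1 - t) * (norm (x - y))\<^sup>2"
    by (simp add: power2_norm_eq_inner inner_simps inner_commute algebra_simps)
  moreover have "t * (1 - t) * (norm (x - y))\<^sup>2 \<ge> 0"
    using t by simp
  ultimately show "(norm ((1 - t) *\<^sub>R x + t *\<^sub>R y))\<^sup>2 \<le> (1 - t) * (norm x)\<^sup>2 + t * (norm y)\<^sup>2"
    by linarith
qed simp

text \<open>
  The elementary form of the first-order condition: the functions minimised below change along a
  segment by at most a linear plus a quadratic term in the step \<open>t\<close>, so no one-sided derivative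
  has to be computed.
\<close>
lemma slope_nonneg_of_quadratic_nonneg:
  fixes a b :: real
  assumes "\<And>t. 0 < t \<Longrightarrow> t < 1 \<Longrightarrow> 0 \<le> t * a + t\<^sup>2 * b"
  shows "0 \<le> a"
proof (rule tendsto_lowerbound)
  show "((\<lambda>t. a + t * b) \<longlongrightarrow> a) (at_right 0)"
    by (auto intro!: tendsto_eq_intros)
  have "0 \<le> a + t * b" if t: "0 < t" "t < 1" for t
  proof -
    have "0 \<le> t * (a + t * b)"
      using assms[OF t] by (simp add: algebra_simps power2_eq_square)
    then show ?thesis
      using t by (simp add: zero_le_mult_iff)
  qed
  moreover have "\<forall>\<^sub>F t in at_right (0::real). 0 < t \<and> t < 1"
    using eventually_at_right_less[of 0] eventually_at_right_real[of 0 1]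
    by (auto elim: eventually_mono)
  ultimately show "\<forall>\<^sub>F t in at_right 0. 0 \<le> a + t * b"
    by (auto elim: eventually_mono)
qed simp

section \<open>Orthogonal projections and adjoints\<close>

text \<open>
  The nearest point of \<open>M\<close> is the projection: moving it by \<open>t h\<close> inside \<open>M\<close> cannot decrease the
  distance, so \<open>x - y\<close> is orthogonal to both \<open>h\<close> and \<open>- h\<close>.
\<close>
lemma orth_proj_exists:
  fixes M :: "'a::{real_inner,complete_space} set"
  assumes M: "subspace M" "closed M"
  shows "\<exists>y. y \<in> M \<and> x - y \<in> orthogonal_comp M"
proof -
  have "\<exists>y\<in>M. \<forall>z\<in>M. dist x y \<le> dist x z"
  proof (rule convex_coercive_attains_minimum)
    show "M \<noteq> {}" "convex_on M (dist x)"
      using M subspace_0 subspace_imp_convex by (auto intro!: convex_on_dist)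
    show "1 * norm y - norm x \<le> dist x y" for y
      using norm_triangle_ineq2[of y x] by (simp add: dist_norm norm_minus_commute)
  qed (use M in \<open>auto intro!: continuous_intros\<close>)
  then obtain y where y: "y \<in> M" "\<And>z. z \<in> M \<Longrightarrow> dist x y \<le> dist x z"
    by blast
  have *: "0 \<le> - 2 * ((x - y) \<bullet> h)" if h: "h \<in> M" for h
  proof (rule slope_nonneg_of_quadratic_nonneg)
    fix t :: real
    have "y + t *\<^sub>R h \<in> M"
      using M(1) y(1) h by (intro subspace_add subspace_scale)
    then have "norm (x - y) \<le> norm (x - (y + t *\<^sub>R h))"
      using y(2) by (simp add: dist_norm)
    then have "(norm (x - y))\<^sup>2 \<le> (norm (x - (y + t *\<^sub>R h)))\<^sup>2"
      by (rule power_mono) simp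
    also have "\<dots> = (norm (x - y))\<^sup>2 + (t * (- 2 * ((x - y) \<bullet> h)) + t\<^sup>2 * (norm h)\<^sup>2)"
      unfolding power2_norm_eq_inner
      by (simp add: inner_simps inner_commute algebra_simps power2_eq_square)
    finally show "0 \<le> t * (- 2 * ((x - y) \<bullet> h)) + t\<^sup>2 * (norm h)\<^sup>2"
      by simp
  qed
  have "(x - y) \<bullet> h = 0" if "h \<in> M" for h
    using *[OF that] *[OF subspace_neg[OF M(1) that]] by simp
  then have "x - y \<in> orthogonal_comp M"
    by (simp add: orthogonal_comp_def orthogonal_def inner_commute)
  with y(1) show ?thesis
    by blast
qed

lemma orth_proj_eqI:
  fixes M :: "'a::real_inner set"
  assumes M: "subspace M" and y: "y \<in> M" "x - y \<in> orthogonal_comp M"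
  shows "orth_proj M x = y"
  unfolding orth_proj_def
proof (rule the_equality)
  fix z assume z: "z \<in> M \<and> x - z \<in> orthogonal_comp M"
  then have "z - y \<in> M"
    using M y by (simp add: subspace_diff)
  moreover have "(x - y) - (x - z) \<in> orthogonal_comp M"
    using y z subspace_diff[OF subspace_orthogonal_comp] by blast
  ultimately have "(z - y) \<bullet> (z - y) = 0"
    by (simp add: orthogonal_comp_def orthogonal_def)
  then show "z = y"
    by simp
qed (use y in blast)

lemma orth_proj_works:
  fixes M :: "'a::{real_inner,complete_space} set"
  assumes M: "subspace M" "closed M"
  shows "orth_proj M x \<in> M" and "x - orth_proj M x \<in> orthogonal_comp M"
  using orth_proj_exists[OF M, of x] orth_proj_eqI[OF M(1)] by auto

lemma closed_orthogonal_comp: "closed (orthogonal_comp W)"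
proof -
  have "orthogonal_comp W = (\<Inter>y\<in>W. {x. y \<bullet> x = 0})"
    by (auto simp: orthogonal_comp_def orthogonal_def)
  then show ?thesis
    by (auto intro!: closed_INT simp: closed_hyperplane)
qed

lemma subspace_closure:
  fixes S :: "'a::real_normed_vector set"
  assumes "subspace S"
  shows "subspace (closure S)"
  unfolding subspace_def
proof safe
  show "0 \<in> closure S"
    using assms closure_subset subspace_0 by blast
next
  fix x y assume "x \<in> closure S" "y \<in> closure S"
  then obtain a b where "\<And>n. a n \<in> S" "a \<longlonglongrightarrow> x" "\<And>n. b n \<in> S" "b \<longlonglongrightarrow> y"
    unfolding closure_sequential by metis
  then have "\<And>n. a n + b n \<in> S" "(\<lambda>n. a n + b n) \<longlonglongrightarrow> x + y"
    using assms by (auto intro: subspace_add tendsto_add)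
  then show "x + y \<in> closure S"
    unfolding closure_sequential by (intro exI[of _ "\<lambda>n. a n + b n"]) simp
next
  fix c :: real and x assume "x \<in> closure S"
  then obtain a where "\<And>n. a n \<in> S" "a \<longlonglongrightarrow> x"
    unfolding closure_sequential by metis
  then have "\<And>n. c *\<^sub>R a n \<in> S" "(\<lambda>n. c *\<^sub>R a n) \<longlonglongrightarrow> c *\<^sub>R x"
    using assms by (auto intro: subspace_scale tendsto_scaleR)
  then show "c *\<^sub>R x \<in> closure S"
    unfolding closure_sequential by (intro exI[of _ "\<lambda>n. c *\<^sub>R a n"]) simp
qed

text \<open>
  The residual \<open>x - y\<close> of the projection onto the closure of \<open>W\<close> is orthogonal to \<open>y\<close>, and also to
  \<open>x\<close>, because it lies in the orthogonal complement of \<open>W\<close>. Hence it is orthogonal to itself.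
\<close>
lemma double_orthogonal_comp_subset_closure:
  fixes W :: "'a::{real_inner,complete_space} set"
  assumes W: "subspace W"
  shows "orthogonal_comp (orthogonal_comp W) \<subseteq> closure W"
proof
  fix x assume x: "x \<in> orthogonal_comp (orthogonal_comp W)"
  define y where "y = orth_proj (closure W) x"
  have y: "y \<in> closure W" "x - y \<in> orthogonal_comp (closure W)"
    unfolding y_def using orth_proj_works[OF subspace_closure[OF W]] by auto
  then have "x - y \<in> orthogonal_comp W"
    using orthogonal_comp_anti_mono[OF closure_subset] by blast
  then have "(x - y) \<bullet> x = 0"
    using x by (auto simp: orthogonal_comp_def orthogonal_def)
  moreover have "(x - y) \<bullet> y = 0"
    using y by (auto simp: orthogonal_comp_def orthogonal_def inner_commute)
  ultimately have "(x - y) \<bullet> (x - y) = 0"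
    by (simp only: inner_diff_right)
  then show "x \<in> closure W"
    using y(1) by simp
qed

lemma orthogonal_projector_inner:
  fixes P :: "'a::{real_inner,complete_space} \<Rightarrow> 'a"
  assumes "orthogonal_projector P"
  shows orthogonal_projector_idem: "P (P x) = P x"
    and orthogonal_projector_sym: "P x \<bullet> y = x \<bullet> P y"
    and orthogonal_projector_norm_complement: "norm (x - P x) \<le> norm x"
proof -
  obtain M where M: "subspace M" "closed M" and P: "P = orth_proj M"
    using assms by (auto simp: orthogonal_projector_def)
  have in_M: "P x \<in> M" for x
    unfolding P using orth_proj_works[OF M] by blast
  have orth: "z \<bullet> (x - P x) = 0" if "z \<in> M" for x z
    using orth_proj_works(2)[OF M, of x] that
    by (auto simp: P orthogonal_comp_def orthogonal_def)
  show "P (P x) = P x"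
    unfolding P using orth_proj_eqI[OF M(1), of "P x" "P x"] in_M[of x]
    by (simp add: P subspace_0[OF subspace_orthogonal_comp])
  have "P x \<bullet> y = P x \<bullet> P y" "P y \<bullet> x = P y \<bullet> P x"
    using orth[OF in_M[of x], of y] orth[OF in_M[of y], of x] by (simp_all add: inner_diff_right)
  then show "P x \<bullet> y = x \<bullet> P y"
    by (simp add: inner_commute)
  have "(norm x)\<^sup>2 = (norm (x - P x))\<^sup>2 + (norm (P x))\<^sup>2"
    using orth[OF in_M[of x], of x]
    by (simp add: power2_norm_eq_inner inner_diff_right inner_diff_left inner_commute)
  then have "(norm (x - P x))\<^sup>2 \<le> (norm x)\<^sup>2"
    using zero_le_power2[of "norm (P x)"] by linarith
  then show "norm (x - P x) \<le> norm x"
    by (rule power2_le_imp_le) simp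
qed

text \<open>
  The representing vector is the minimiser of \<open>\<parallel>x\<parallel>\<^sup>2 / 2 - f x\<close>, whose stationarity condition is
  exactly \<open>(w, h) = f h\<close>.
\<close>
lemma Riesz_representation:
  fixes f :: "'a::{real_inner,complete_space} \<Rightarrow> real"
  assumes f: "bounded_linear f"
  shows "\<exists>w. \<forall>x. f x = x \<bullet> w"
proof -
  interpret f: bounded_linear f by fact
  obtain K where K: "\<And>x. norm (f x) \<le> norm x * K"
    using f.bounded by blast
  define J where "J x = 1 / 2 * (norm x)\<^sup>2 - f x" for x
  have "\<exists>w\<in>UNIV. \<forall>y\<in>UNIV. J w \<le> J y"
  proof (rule convex_coercive_attains_minimum)
    have "convex_on UNIV (\<lambda>x. - f x)"
      by (simp add: convex_on_def f.add f.scaleR)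
    then have "convex_on UNIV (\<lambda>x. 1 / 2 * (norm x)\<^sup>2 + - f x)"
      by (intro convex_on_add convex_on_cmul convex_on_norm_square) auto
    then show "convex_on UNIV J"
      by (simp add: J_def[abs_def])
    show "continuous_on UNIV J"
      unfolding J_def by (intro continuous_intros f.continuous_on)
    show "1 * norm x - (K + 1)\<^sup>2 / 2 \<le> J x" for x
    proof -
      have "0 \<le> (norm x - (K + 1))\<^sup>2"
        by simp
      then have "norm x * (K + 1) \<le> 1 / 2 * (norm x)\<^sup>2 + (K + 1)\<^sup>2 / 2"
        by (simp add: power2_eq_square field_simps)
      then show ?thesis
        using K[of x] by (simp add: J_def algebra_simps)
    qed
  qed auto
  then obtain w where w: "\<And>y. J w \<le> J y"
    by auto
  have *: "0 \<le> h \<bullet> w - f h" for h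
  proof (rule slope_nonneg_of_quadratic_nonneg)
    fix t :: real
    have "J w \<le> J (w + t *\<^sub>R h)"
      by (rule w)
    also have "\<dots> = J w + (t * (h \<bullet> w - f h) + t\<^sup>2 * (1 / 2 * (norm h)\<^sup>2))"
      unfolding J_def power2_norm_eq_inner
      by (simp add: f.add f.scaleR inner_simps inner_commute algebra_simps power2_eq_square)
    finally show "0 \<le> t * (h \<bullet> w - f h) + t\<^sup>2 * (1 / 2 * (norm h)\<^sup>2)"
      by simp
  qed
  have "f x = x \<bullet> w" for x
    using *[of x] *[of "- x"] by (simp add: f.neg)
  then show ?thesis
    by blast
qed

text \<open>
  The Riesz representation supplies a witness for the choice in the definition of the adjoint,
  in infinite dimension as well.
\<close>
lemma adjoint_inner:
  fixes A :: "'v::{real_inner,complete_space} \<Rightarrow> 'h::real_inner"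
  assumes A: "bounded_linear A"
  shows "A x \<bullet> y = x \<bullet> adjoint A y"
proof -
  have "\<exists>w. \<forall>x. A x \<bullet> y = x \<bullet> w" for y
    using Riesz_representation[OF bounded_linear_compose[OF bounded_linear_inner_left A]] .
  then have "\<exists>f'. \<forall>x y. A x \<bullet> y = x \<bullet> f' y"
    by metis
  then have "\<forall>x y. A x \<bullet> y = x \<bullet> adjoint A y"
    unfolding adjoint_def by (rule someI_ex)
  then show ?thesis
    by blast
qed

lemma bounded_linear_adjoint:
  fixes A :: "'v::{real_inner,complete_space} \<Rightarrow> 'h::real_inner"
  assumes A: "bounded_linear A"
  shows "bounded_linear (adjoint A)"
proof -
  note adj = adjoint_inner[OF A, symmetric]
  obtain K where K0: "K \<ge> 0" and K: "\<And>x. norm (A x) \<le> norm x * K"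
    using bounded_linear.nonneg_bounded[OF A] by blast
  show ?thesis
  proof (rule bounded_linear_intro)
    show "adjoint A (x + y) = adjoint A x + adjoint A y" for x y
      by (subst vector_eq_ldot[symmetric]) (simp add: adj inner_add_right)
    show "adjoint A (r *\<^sub>R x) = r *\<^sub>R adjoint A x" for r x
      by (subst vector_eq_ldot[symmetric]) (simp add: adj)
    show "norm (adjoint A y) \<le> norm y * K" for y
    proof (cases "adjoint A y = 0")
      case True
      then show ?thesis
        using K0 by simp
    next
      case False
      have "norm (adjoint A y) * norm (adjoint A y) = A (adjoint A y) \<bullet> y"
        by (simp add: adjoint_inner[OF A] power2_norm_eq_inner flip: power2_eq_square)
      also have "\<dots> \<le> norm (A (adjoint A y)) * norm y"
        by (rule norm_cauchy_schwarz)
      also have "\<dots> \<le> norm (adjoint A y) * K * norm y"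
        by (intro mult_right_mono K) simp
      finally show ?thesis
        using False by (simp add: mult_ac)
    qed
  qed
qed

section \<open>Coercivity of the objective\<close>

text \<open>
  An Ehrling-type inequality. The unit vector \<open>x\<close> in the direction of \<open>P q\<close> is fixed by \<open>P\<close>, so
  \<open>\<parallel>P q\<parallel> = (x, P q) = (x, q)\<close>. It lies in the closure of the \<open>P\<close>-image of the unit ball, a compact
  subset of the closure of the range of \<open>A\<close>, hence within \<open>\<epsilon>\<close> of some \<open>A v\<close> with \<open>v\<close> from a finite set that
  does not depend on \<open>q\<close>. Replacing \<open>x\<close> by \<open>A v\<close> turns \<open>(x, q)\<close> into \<open>(v, A\<^sup>* q)\<close>.
\<close>
lemma compact_projector_Ehrling:
  fixes A :: "'v::{real_inner,complete_space} \<Rightarrow> 'h::{real_inner,complete_space}"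
  assumes A: "bounded_linear A" and P: "orthogonal_projector P" "compact_operator P"
    and range: "range P \<subseteq> closure (range A)" and \<epsilon>: "\<epsilon> > 0"
  shows "\<exists>C\<ge>0. \<forall>q. norm (P q) \<le> \<epsilon> * norm q + C * norm (adjoint A q)"
proof -
  interpret P: bounded_linear P
    using P(2) by (simp add: compact_operator_def)
  define K where "K = closure (P ` cball 0 1)"
  have "compact K"
    using P(2) by (simp add: K_def compact_operator_def)
  moreover have "K \<subseteq> closure (range A)"
    unfolding K_def using range by (intro closure_minimal) auto
  then have "K \<subseteq> (\<Union>v\<in>UNIV. ball (A v) \<epsilon>)"
    using \<epsilon> by (fastforce simp: closure_approachable)
  ultimately obtain F where F: "finite F" "K \<subseteq> (\<Union>v\<in>F. ball (A v) \<epsilon>)"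
    using compactE_image[of K UNIV "\<lambda>v. ball (A v) \<epsilon>"] by auto
  define C where "C = (\<Sum>v\<in>F. norm v)"
  have "norm (P q) \<le> \<epsilon> * norm q + C * norm (adjoint A q)" for q
  proof (cases "P q = 0")
    case True
    then show ?thesis
      using \<epsilon> by (simp add: C_def sum_nonneg)
  next
    case False
    define x where "x = P q /\<^sub>R norm (P q)"
    have Px: "P x = x"
      by (simp add: x_def P.scaleR orthogonal_projector_idem[OF P(1)])
    have "norm x = 1"
      using False by (simp add: x_def)
    then have "x \<in> P ` cball 0 1"
      using Px by (intro image_eqI[of _ _ x]) auto
    then have "x \<in> K"
      unfolding K_def by (rule subsetD[OF closure_subset])
    then obtain v where v: "v \<in> F" "dist (A v) x < \<epsilon>"
      using F(2) by auto
    have "norm v \<le> C"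
      unfolding C_def using F(1) v(1) by (intro member_le_sum) auto
    have "norm (P q) = x \<bullet> P q"
      using False by (simp add: x_def flip: power2_norm_eq_inner) (simp add: power2_eq_square)
    also have "\<dots> = x \<bullet> q"
      using orthogonal_projector_sym[OF P(1), of x q] Px by simp
    also have "\<dots> = (x - A v) \<bullet> q + v \<bullet> adjoint A q"
      by (simp add: adjoint_inner[OF A, symmetric] inner_diff_left)
    also have "\<dots> \<le> norm (x - A v) * norm q + norm v * norm (adjoint A q)"
      by (intro add_mono norm_cauchy_schwarz)
    also have "\<dots> \<le> \<epsilon> * norm q + C * norm (adjoint A q)"
      using v(2) \<open>norm v \<le> C\<close>
      by (intro add_mono mult_right_mono) (auto simp: dist_norm norm_minus_commute)
    finally show ?thesis .
  qed
  moreover have "C \<ge> 0"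
    by (simp add: C_def sum_nonneg)
  ultimately show ?thesis
    by blast
qed

text \<open>
  Only the component of \<open>g\<close> orthogonal to the range of \<open>A\<close> is seen at full size: the rest is a limit
  of vectors \<open>A v\<close>, and \<open>(A v, q) = (v, A\<^sup>* q)\<close>.
\<close>
lemma inner_le_by_orthogonal_part:
  fixes A :: "'v::{real_inner,complete_space} \<Rightarrow> 'h::{real_inner,complete_space}"
  assumes A: "bounded_linear A" and \<epsilon>: "\<epsilon> > 0"
  shows "\<exists>C. \<forall>q. g \<bullet> q \<le>
    (norm (orth_proj (orthogonal_comp (range A)) g) + \<epsilon>) * norm q + C * norm (adjoint A q)"
proof -
  define g' where "g' = orth_proj (orthogonal_comp (range A)) g"
  have "subspace (range A)"
    using A bounded_linear.linear linear_subspace_image subspace_UNIV by blast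
  then have "g - g' \<in> closure (range A)"
    unfolding g'_def
    using orth_proj_works(2)[OF subspace_orthogonal_comp closed_orthogonal_comp]
      double_orthogonal_comp_subset_closure by blast
  then obtain v where v: "dist (A v) (g - g') < \<epsilon>"
    using \<epsilon> by (auto simp: closure_approachable)
  have "g \<bullet> q \<le> (norm g' + \<epsilon>) * norm q + norm v * norm (adjoint A q)" for q
  proof -
    have "g \<bullet> q = g' \<bullet> q + (g - g' - A v) \<bullet> q + v \<bullet> adjoint A q"
      by (simp add: adjoint_inner[OF A, symmetric] inner_diff_left)
    also have "\<dots> \<le> norm g' * norm q + norm (g - g' - A v) * norm q + norm v * norm (adjoint A q)"
      by (intro add_mono norm_cauchy_schwarz)
    also have "\<dots> \<le> norm g' * norm q + \<epsilon> * norm q + norm v * norm (adjoint A q)"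
      using v by (intro add_mono mult_right_mono) (auto simp: dist_norm norm_minus_commute)
    finally show ?thesis
      by (simp add: algebra_simps)
  qed
  then show ?thesis
    unfolding g'_def by blast
qed

text \<open>
  The gap between \<open>\<delta>\<close> and the norm \<open>\<eta>\<close> of the orthogonal part of \<open>g\<close> is divided into three parts
  \<open>c\<close>: one is spent on the error in estimating \<open>P q\<close>, one on the error in estimating \<open>(g, q)\<close>, and
  one remains as the growth rate. The collected terms \<open>B \<parallel>A\<^sup>* q\<parallel>\<close> are absorbed by
  \<open>\<parallel>A\<^sup>* q\<parallel>\<^sup>2 / 2\<close> at the price of the constant \<open>B\<^sup>2 / 2\<close>.
\<close>
lemma G_obj_coercive:
  fixes A :: "'v::{real_inner,complete_space} \<Rightarrow> 'h::{real_inner,complete_space}"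
  assumes A: "bounded_linear A" and P: "orthogonal_projector P" "compact_operator P"
    and range: "range P \<subseteq> closure (range A)" and \<delta>: "\<delta> > 0"
    and g: "norm (orth_proj (orthogonal_comp (range A)) g) < \<delta>"
  shows "\<exists>c>0. \<exists>b. \<forall>q. c * norm q - b \<le> G_obj A P \<delta> g q"
proof -
  define \<eta> where "\<eta> = norm (orth_proj (orthogonal_comp (range A)) g)"
  define c where "c = (\<delta> - \<eta>) / 3"
  have c: "c > 0"
    using g by (simp add: c_def \<eta>_def)
  obtain C where C: "\<And>q. norm (P q) \<le> c / \<delta> * norm q + C * norm (adjoint A q)"
    using compact_projector_Ehrling[OF A P range, of "c / \<delta>"] c \<delta> by auto
  obtain D where D: "\<And>q. g \<bullet> q \<le> (\<eta> + c) * norm q + D * norm (adjoint A q)"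
    using inner_le_by_orthogonal_part[OF A c, of g] unfolding \<eta>_def by auto
  define B where "B = \<delta> * C + D"
  have "c * norm q - B\<^sup>2 / 2 \<le> G_obj A P \<delta> g q" for q
  proof -
    define a where "a = norm (adjoint A q)"
    have "norm q \<le> norm (q - P q) + norm (P q)"
      using norm_triangle_ineq[of "q - P q" "P q"] by simp
    also have "\<dots> \<le> norm (q - P q) + (c / \<delta> * norm q + C * a)"
      using C[of q] by (simp add: a_def)
    finally have "\<delta> * norm q \<le> \<delta> * (norm (q - P q) + (c / \<delta> * norm q + C * a))"
      using \<delta> by (intro mult_left_mono) auto
    also have "\<dots> = \<delta> * norm (q - P q) + c * norm q + \<delta> * C * a"
      using \<delta> by (simp add: field_simps)
    finally have 1: "\<delta> * norm q \<le> \<delta> * norm (q - P q) + c * norm q + \<delta> * C * a" .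
    have 2: "g \<bullet> q \<le> (\<eta> + c) * norm q + D * a"
      using D[of q] by (simp add: a_def)
    have "\<delta> = \<eta> + 3 * c"
      by (simp add: c_def field_simps)
    then have 3: "\<delta> * norm q = (\<eta> + 3 * c) * norm q"
      by (rule arg_cong)
    have "0 \<le> (a - B)\<^sup>2"
      by simp
    then have 4: "B * a \<le> 1 / 2 * a\<^sup>2 + B\<^sup>2 / 2"
      by (simp add: power2_eq_square algebra_simps)
    show ?thesis
      using 1 2 3 4 by (simp add: G_obj_def B_def algebra_simps flip: a_def)
  qed
  then show ?thesis
    using c by blast
qed

lemma G_obj_has_minimiser:
  fixes A :: "'v::{real_inner,complete_space} \<Rightarrow> 'h::{real_inner,complete_space}"
  assumes A: "bounded_linear A" and P: "orthogonal_projector P" "compact_operator P"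
    and range: "range P \<subseteq> closure (range A)" and \<delta>: "\<delta> > 0"
    and g: "norm (orth_proj (orthogonal_comp (range A)) g) < \<delta>"
  shows "\<exists>p. \<forall>q. G_obj A P \<delta> g p \<le> G_obj A P \<delta> g q"
proof -
  interpret A': bounded_linear "adjoint A"
    by (rule bounded_linear_adjoint[OF A])
  interpret P: bounded_linear P
    using P(2) by (simp add: compact_operator_def)
  obtain c b where cb: "c > 0" "\<And>q. c * norm q - b \<le> G_obj A P \<delta> g q"
    using G_obj_coercive[OF assms] by blast
  have "\<exists>p\<in>UNIV. \<forall>q\<in>UNIV. G_obj A P \<delta> g p \<le> G_obj A P \<delta> g q"
  proof (rule convex_coercive_attains_minimum)
    have "convex_on UNIV (\<lambda>q. (norm (adjoint A q))\<^sup>2)"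
      using convex_on_compose_linear[OF convex_on_norm_square A'.linear_axioms] .
    moreover have "convex_on UNIV (\<lambda>x::'h. norm x)"
      using convex_on_dist[of UNIV "0::'h"] by simp
    then have "convex_on UNIV (\<lambda>q. norm (q - P q))"
      by (rule convex_on_compose_linear) (intro linear_compose_sub linear_ident P.linear_axioms)
    moreover have "convex_on UNIV (\<lambda>q. - (g \<bullet> q))"
      by (simp add: convex_on_def inner_simps)
    ultimately have "convex_on UNIV
        (\<lambda>q. 1 / 2 * (norm (adjoint A q))\<^sup>2 + \<delta> * norm (q - P q) + - (g \<bullet> q))"
      using \<delta> by (intro convex_on_add convex_on_cmul) auto
    then show "convex_on UNIV (G_obj A P \<delta> g)"
      by (simp add: G_obj_def[abs_def])
    show "continuous_on UNIV (G_obj A P \<delta> g)"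
      unfolding G_obj_def[abs_def] by (intro continuous_intros A'.continuous_on P.continuous_on)
  qed (use cb in auto)
  then show ?thesis
    by auto
qed

section \<open>Optimality conditions\<close>

text \<open>
  The norm term of the objective is not differentiable, but the triangle inequality bounds its
  increment from above along \<open>p + t h\<close> for \<open>t > 0\<close>, which gives the inequality. The equation is the
  case \<open>h = p\<close> together with the opposite direction \<open>h = - p\<close>, where the norm term is exactly
  linear: \<open>\<parallel>(1 - t) (p - P p)\<parallel> = (1 - t) \<parallel>p - P p\<parallel>\<close>.
\<close>
lemma G_obj_first_variation:
  fixes A :: "'v::{real_inner,complete_space} \<Rightarrow> 'h::real_inner"
  assumes A: "bounded_linear A" and P: "bounded_linear P" and \<delta>: "\<delta> \<ge> 0"
    and min: "\<And>q. G_obj A P \<delta> g p \<le> G_obj A P \<delta> g q"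
  shows "0 \<le> (A (adjoint A p) - g) \<bullet> h + \<delta> * norm (h - P h)"
    and "(norm (adjoint A p))\<^sup>2 + \<delta> * norm (p - P p) - g \<bullet> p = 0"
proof -
  interpret A': bounded_linear "adjoint A"
    by (rule bounded_linear_adjoint[OF A])
  interpret P: bounded_linear P
    by (rule P)
  have expand: "(norm (adjoint A (p + t *\<^sub>R h)))\<^sup>2 = (norm (adjoint A p))\<^sup>2
      + 2 * t * (A (adjoint A p) \<bullet> h) + t\<^sup>2 * (norm (adjoint A h))\<^sup>2" for t h
    unfolding power2_norm_eq_inner adjoint_inner[OF A]
    by (simp add: A'.add A'.scaleR inner_simps inner_commute algebra_simps power2_eq_square)
  show var: "0 \<le> (A (adjoint A p) - g) \<bullet> h + \<delta> * norm (h - P h)" for h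
  proof (rule slope_nonneg_of_quadratic_nonneg)
    fix t :: real assume t: "0 < t"
    have "(p + t *\<^sub>R h) - P (p + t *\<^sub>R h) = (p - P p) + t *\<^sub>R (h - P h)"
      by (simp add: P.add P.scaleR algebra_simps)
    then have "norm ((p + t *\<^sub>R h) - P (p + t *\<^sub>R h)) \<le> norm (p - P p) + t * norm (h - P h)"
      using norm_triangle_ineq[of "p - P p" "t *\<^sub>R (h - P h)"] t
      by (simp only: norm_scaleR abs_of_pos)
    then have "\<delta> * norm ((p + t *\<^sub>R h) - P (p + t *\<^sub>R h))
        \<le> \<delta> * (norm (p - P p) + t * norm (h - P h))"
      using \<delta> by (rule mult_left_mono)
    then show "0 \<le> t * ((A (adjoint A p) - g) \<bullet> h + \<delta> * norm (h - P h))
        + t\<^sup>2 * (1 / 2 * (norm (adjoint A h))\<^sup>2)"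
      using min[of "p + t *\<^sub>R h"] unfolding G_obj_def expand
      by (simp add: inner_simps algebra_simps)
  qed
  \<comment> \<open>The step is restricted to \<open>t < 1\<close> so that the factor \<open>1 - t\<close> leaves the norm.\<close>
  have "0 \<le> - ((A (adjoint A p) - g) \<bullet> p + \<delta> * norm (p - P p))"
  proof (rule slope_nonneg_of_quadratic_nonneg)
    fix t :: real assume t: "0 < t" "t < 1"
    have "(p + t *\<^sub>R (- p)) - P (p + t *\<^sub>R (- p)) = (1 - t) *\<^sub>R (p - P p)"
      by (simp add: P.diff P.scaleR algebra_simps)
    then have scaled: "norm ((p + t *\<^sub>R (- p)) - P (p + t *\<^sub>R (- p))) = (1 - t) * norm (p - P p)"
      using t by simp
    then show "0 \<le> t * - ((A (adjoint A p) - g) \<bullet> p + \<delta> * norm (p - P p))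
        + t\<^sup>2 * (1 / 2 * (norm (adjoint A p))\<^sup>2)"
      using min[of "p + t *\<^sub>R (- p)"] unfolding G_obj_def expand scaled
      by (simp add: A'.neg inner_simps algebra_simps)
  qed
  moreover have "A (adjoint A p) \<bullet> p = (norm (adjoint A p))\<^sup>2"
    by (simp add: adjoint_inner[OF A] power2_norm_eq_inner)
  ultimately show "(norm (adjoint A p))\<^sup>2 + \<delta> * norm (p - P p) - g \<bullet> p = 0"
    using var[of p] by (simp add: inner_diff_left)
qed

text \<open>
  The test direction \<open>- P r\<close> annihilates \<open>h - P h\<close> and forces \<open>P r = 0\<close>; the direction \<open>- r\<close> then
  bounds \<open>\<parallel>r\<parallel>\<^sup>2\<close> by \<open>\<delta> \<parallel>r\<parallel>\<close>.
\<close>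
lemma variational_inequality_imp_residual:
  fixes P :: "'h::{real_inner,complete_space} \<Rightarrow> 'h"
  assumes P: "orthogonal_projector P" "bounded_linear P" and \<delta>: "\<delta> \<ge> 0"
    and var: "\<And>h. 0 \<le> r \<bullet> h + \<delta> * norm (h - P h)"
  shows "norm r \<le> \<delta>" and "P r = 0"
proof -
  interpret P: bounded_linear P
    by (rule P)
  have "r \<bullet> P r = P r \<bullet> P r"
    using orthogonal_projector_sym[OF P(1), of r "P r"]
    by (simp add: orthogonal_projector_idem[OF P(1)])
  then have "P r \<bullet> P r \<le> 0"
    using var[of "- P r"] by (simp add: P.neg orthogonal_projector_idem[OF P(1)])
  then show "P r = 0"
    by (simp add: inner_gt_zero_iff flip: not_less)
  then have "r \<bullet> r \<le> \<delta> * norm r"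
    using var[of "- r"] by (simp add: P.neg)
  then have "norm r * norm r \<le> \<delta> * norm r"
    by (simp add: power2_norm_eq_inner flip: power2_eq_square)
  then show "norm r \<le> \<delta>"
    using \<delta> by (cases "r = 0") auto
qed

theorem theorem2p2:
  fixes A :: "'v::{real_inner,complete_space} \<Rightarrow> 'h::{real_inner,complete_space}"
    and P :: "'h \<Rightarrow> 'h"
    and \<delta> :: real
    and g :: 'h
  assumes "bounded_linear A"
    and "inj A"
    and "orthogonal_projector P"
    and "compact_operator P"
    and "range P \<subseteq> closure (range A)"
    and "\<delta> > 0"
    and "norm (orth_proj (orthogonal_comp (range A)) g) < \<delta>"
  shows "(\<exists>p. is_arg_min (G_obj A P \<delta> g) (\<lambda>q. q \<in> UNIV) p) \<and>
    (\<forall>p. is_arg_min (G_obj A P \<delta> g) (\<lambda>q. q \<in> UNIV) p \<longrightarrow>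
      adjoint A p \<in> K_set A P \<delta> g \<and>
      (norm (adjoint A p))\<^sup>2 + 2 * G_obj A P \<delta> g p = 0)"
proof (intro conjI allI impI)
  show "\<exists>p. is_arg_min (G_obj A P \<delta> g) (\<lambda>q. q \<in> UNIV) p"
    using G_obj_has_minimiser[OF assms(1,3-7)] by (simp add: is_arg_min_linorder)
next
  fix p assume "is_arg_min (G_obj A P \<delta> g) (\<lambda>q. q \<in> UNIV) p"
  then have min: "\<And>q. G_obj A P \<delta> g p \<le> G_obj A P \<delta> g q"
    by (simp add: is_arg_min_linorder)
  have P: "bounded_linear P"
    using assms(4) by (simp add: compact_operator_def)
  note variation = G_obj_first_variation[OF assms(1) P less_imp_le[OF assms(6)] min]
  note residual = variational_inequality_imp_residual[OF assms(3) P less_imp_le[OF assms(6)] variation(1)]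
  show "adjoint A p \<in> K_set A P \<delta> g"
    using residual by (simp add: K_set_def bounded_linear.linear[OF P] linear_diff)
  show "(norm (adjoint A p))\<^sup>2 + 2 * G_obj A P \<delta> g p = 0"
    using variation(2) by (simp add: G_obj_def)
qed

end
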